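(* Let $n\ge 0$ be an integer, and let $V(n)$ be the $(n+1)$-dimensional simple module of the complex Lie algebra $\mathfrak{sl}(2)$. Then every 2-local derivation $g:\mathfrak{sl}(2)\to V(n)$ of $\mathfrak{sl}(2)$ on $V(n)$ is a derivation of $\mathfrak{sl}(2)$ on $V(n)$.
   Context: All Lie algebras and modules are finite-dimensional over $\mathbb{C}$. For a Lie algebra $L$ and an $L$-module $V$, a derivation of $L$ on $V$ is a linear map $D:L\to V$ such that $D([x,y])=xD(y)-yD(x)$ for all $x,y\in L$; the set of these is denoted $\mathrm{Der}(L,V)$. A 2-local derivation of $L$ on $V$ is a map $g:L\to V$ (not assumed linear) such that for any $x,y\in L$ there exists $D_{x,y}\in\mathrm{Der}(L,V)$ (depending on $x,y$) with $g(x)=D_{x,y}(x)$ and $g(y)=D_{x,y}(y)$. $\mathfrak{sl}(2)$ is the 3-dimensional complex simple Lie algebra of traceless $2\times 2$ matrices with standard basis $e=\begin{pmatrix}0&1\\0&0\end{pmatrix}$, $h=\begin{pmatrix}1&0\\0&-1\end{pmatrix}$, $f=\begin{pmatrix}0&0\\1&0\end{pmatrix}$. The simple module $V(n)$ has basis $v_0,v_1,\ldots,v_n$ with action $ev_i=i(n+1-i)v_{i-1}$, $hv_i=(n-2i)v_i$, $fv_i=v_{i+1}$ for $0\le i\le n$, where $v_{-1}=v_{n+1}=0$. *)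

theory Defs
  imports "HOL-Analysis.Analysis" "HOL-Library.Function_Algebras"
begin

text \<open>Lie algebras and modules are finite-dimensional subspaces \<open>L\<close> and \<open>V\<close> of ambient complex
  vector spaces; nothing is required of the operations outside these carriers.\<close>

locale lie_algebra = L: vector_space scaleL
  for scaleL :: "complex \<Rightarrow> 'l::ab_group_add \<Rightarrow> 'l" +
  fixes L :: "'l set" and bracket :: "'l \<Rightarrow> 'l \<Rightarrow> 'l"
  assumes L_subspace: "L.subspace L"
    and L_finite_dim: "\<exists>B. finite B \<and> L = L.span B"
    and bracket_closed: "\<lbrakk>x \<in> L; y \<in> L\<rbrakk> \<Longrightarrow> bracket x y \<in> L"
    and bracket_add_left: "\<lbrakk>x \<in> L; y \<in> L; z \<in> L\<rbrakk> \<Longrightarrow> bracket (x + y) z = bracket x z + bracket y z"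
    and bracket_add_right: "\<lbrakk>x \<in> L; y \<in> L; z \<in> L\<rbrakk> \<Longrightarrow> bracket x (y + z) = bracket x y + bracket x z"
    and bracket_scale_left: "\<lbrakk>x \<in> L; y \<in> L\<rbrakk> \<Longrightarrow> bracket (scaleL c x) y = scaleL c (bracket x y)"
    and bracket_scale_right: "\<lbrakk>x \<in> L; y \<in> L\<rbrakk> \<Longrightarrow> bracket x (scaleL c y) = scaleL c (bracket x y)"
    and bracket_self: "x \<in> L \<Longrightarrow> bracket x x = 0"
    and jacobi: "\<lbrakk>x \<in> L; y \<in> L; z \<in> L\<rbrakk> \<Longrightarrow>
      bracket x (bracket y z) + bracket y (bracket z x) + bracket z (bracket x y) = 0"

locale lie_module = lie_algebra scaleL L bracket + V: vector_space scaleV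
  for scaleL :: "complex \<Rightarrow> 'l::ab_group_add \<Rightarrow> 'l" and L bracket
    and scaleV :: "complex \<Rightarrow> 'v::ab_group_add \<Rightarrow> 'v" +
  fixes V :: "'v set" and act :: "'l \<Rightarrow> 'v \<Rightarrow> 'v"
  assumes V_subspace: "V.subspace V"
    and V_finite_dim: "\<exists>B. finite B \<and> V = V.span B"
    and act_closed: "\<lbrakk>x \<in> L; v \<in> V\<rbrakk> \<Longrightarrow> act x v \<in> V"
    and act_add_left: "\<lbrakk>x \<in> L; y \<in> L; v \<in> V\<rbrakk> \<Longrightarrow> act (x + y) v = act x v + act y v"
    and act_add_right: "\<lbrakk>x \<in> L; v \<in> V; w \<in> V\<rbrakk> \<Longrightarrow> act x (v + w) = act x v + act x w"
    and act_scale_left: "\<lbrakk>x \<in> L; v \<in> V\<rbrakk> \<Longrightarrow> act (scaleL c x) v = scaleV c (act x v)"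
    and act_scale_right: "\<lbrakk>x \<in> L; v \<in> V\<rbrakk> \<Longrightarrow> act x (scaleV c v) = scaleV c (act x v)"
    and act_bracket: "\<lbrakk>x \<in> L; y \<in> L; v \<in> V\<rbrakk> \<Longrightarrow>
      act (bracket x y) v = act x (act y v) - act y (act x v)"
begin

text \<open>Maps \<open>L \<rightarrow> V\<close> are total functions of which only the values on \<open>L\<close> matter.\<close>

definition derivation :: "('l \<Rightarrow> 'v) \<Rightarrow> bool" where
  "derivation D \<longleftrightarrow>
     D \<in> L \<rightarrow> V \<and>
     (\<forall>x\<in>L. \<forall>y\<in>L. D (x + y) = D x + D y) \<and>
     (\<forall>c. \<forall>x\<in>L. D (scaleL c x) = scaleV c (D x)) \<and>
     (\<forall>x\<in>L. \<forall>y\<in>L. D (bracket x y) = act x (D y) - act y (D x))"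

definition two_local_derivation :: "('l \<Rightarrow> 'v) \<Rightarrow> bool" where
  "two_local_derivation g \<longleftrightarrow>
     g \<in> L \<rightarrow> V \<and>
     (\<forall>x\<in>L. \<forall>y\<in>L. \<exists>D. derivation D \<and> g x = D x \<and> g y = D y)"

definition simple_module :: bool where
  "simple_module \<longleftrightarrow>
     V \<noteq> {0} \<and>
     (\<forall>W. V.subspace W \<and> W \<subseteq> V \<and> (\<forall>x\<in>L. \<forall>w\<in>W. act x w \<in> W) \<longrightarrow> W = {0} \<or> W = V)"

end

definition mat_scale :: "complex \<Rightarrow> complex^2^2 \<Rightarrow> complex^2^2" where
  "mat_scale c A = (\<chi> i j. c * A$i$j)"

definition sl2 :: "(complex^2^2) set" where
  "sl2 = {A. trace A = 0}"

definition commutator :: "complex^2^2 \<Rightarrow> complex^2^2 \<Rightarrow> complex^2^2" where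
  "commutator A B = A ** B - B ** A"

definition sl2_e :: "complex^2^2" where "sl2_e = vector [vector [0, 1], vector [0, 0]]"
definition sl2_h :: "complex^2^2" where "sl2_h = vector [vector [1, 0], vector [0, -1]]"
definition sl2_f :: "complex^2^2" where "sl2_f = vector [vector [0, 0], vector [1, 0]]"

text \<open>An element \<open>x\<close> of \<open>V(n)\<close> is given by its coordinates: \<open>x = (\<Sum>i\<le>n. x i \<cdot> v\<^sub>i)\<close>.\<close>

definition coord_scale :: "complex \<Rightarrow> (nat \<Rightarrow> complex) \<Rightarrow> nat \<Rightarrow> complex" where
  "coord_scale c x = (\<lambda>j. c * x j)"

definition V :: "nat \<Rightarrow> (nat \<Rightarrow> complex) set" where
  "V n = {x. \<forall>j>n. x j = 0}"

text \<open>\<open>v n (n + 1) = 0\<close>, matching the convention for \<open>V(n)\<close>.\<close>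

definition v :: "nat \<Rightarrow> nat \<Rightarrow> nat \<Rightarrow> complex" where
  "v n i = (\<lambda>j. if j = i \<and> i \<le> n then 1 else 0)"

text \<open>The actions of \<open>e\<close>, \<open>h\<close>, \<open>f\<close> are given on \<open>v\<^sub>0, \<dots>, v\<^sub>n\<close> and extended linearly. For \<open>i = 0\<close>
  the truncated index \<open>i - 1\<close> in \<open>e_act\<close> is harmless because its coefficient vanishes.\<close>

definition e_act :: "nat \<Rightarrow> (nat \<Rightarrow> complex) \<Rightarrow> nat \<Rightarrow> complex" where
  "e_act n x = (\<Sum>i\<le>n. coord_scale (x i)
     (coord_scale (of_nat i * (of_nat n + 1 - of_nat i)) (v n (i - 1))))"

definition h_act :: "nat \<Rightarrow> (nat \<Rightarrow> complex) \<Rightarrow> nat \<Rightarrow> complex" where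
  "h_act n x = (\<Sum>i\<le>n. coord_scale (x i) (coord_scale (of_nat n - 2 * of_nat i) (v n i)))"

definition f_act :: "nat \<Rightarrow> (nat \<Rightarrow> complex) \<Rightarrow> nat \<Rightarrow> complex" where
  "f_act n x = (\<Sum>i\<le>n. coord_scale (x i) (v n (i + 1)))"

text \<open>A traceless matrix \<open>A\<close> equals \<open>A\<^sub>1\<^sub>2 e + A\<^sub>1\<^sub>1 h + A\<^sub>2\<^sub>1 f\<close>.\<close>

definition V_act :: "nat \<Rightarrow> complex^2^2 \<Rightarrow> (nat \<Rightarrow> complex) \<Rightarrow> nat \<Rightarrow> complex" where
  "V_act n A x = coord_scale (A$1$2) (e_act n x) + coord_scale (A$1$1) (h_act n x)
     + coord_scale (A$2$1) (f_act n x)"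

lemma sl2_decomp:
  assumes "A \<in> sl2"
  shows "A = mat_scale (A$1$2) sl2_e + mat_scale (A$1$1) sl2_h + mat_scale (A$2$1) sl2_f"
proof -
  have "A$2$2 = - A$1$1"
    using assms by (simp add: sl2_def trace_def sum_2 eq_neg_iff_add_eq_0 add.commute)
  then show ?thesis
    by (simp add: mat_scale_def sl2_e_def sl2_h_def sl2_f_def vec_eq_iff forall_2)
qed

lemma sl2_basis_in: "sl2_e \<in> sl2" "sl2_h \<in> sl2" "sl2_f \<in> sl2"
  by (simp_all add: sl2_def trace_def sum_2 sl2_e_def sl2_h_def sl2_f_def)

lemma sum_fun_apply: "(\<Sum>i\<in>A. F i) j = (\<Sum>i\<in>A. F i (j::nat) :: complex)"
  by (induction A rule: infinite_finite_induct) auto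

lemma e_act_apply:
  "e_act n x j = (if j < n then of_nat (Suc j) * (of_nat n - of_nat j) * x (Suc j) else 0)"
proof -
  have "e_act n x j = (\<Sum>i\<le>n. if i = Suc j then of_nat i * (of_nat n + 1 - of_nat i) * x i else 0)"
    unfolding e_act_def sum_fun_apply
    by (rule sum.cong) (auto simp: coord_scale_def v_def)
  then show ?thesis by (auto simp: Suc_le_eq)
qed

lemma h_act_apply: "h_act n x j = (if j \<le> n then (of_nat n - 2 * of_nat j) * x j else 0)"
proof -
  have "h_act n x j = (\<Sum>i\<le>n. if i = j then (of_nat n - 2 * of_nat i) * x i else 0)"
    unfolding h_act_def sum_fun_apply
    by (rule sum.cong) (auto simp: coord_scale_def v_def)
  then show ?thesis by auto
qed

lemma f_act_apply: "f_act n x j = (if 1 \<le> j \<and> j \<le> n then x (j - 1) else 0)"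
proof -
  have "f_act n x j = (\<Sum>i\<le>n. if i = j - 1 then (if 1 \<le> j \<and> j \<le> n then x i else 0) else 0)"
    unfolding f_act_def sum_fun_apply
    by (rule sum.cong) (auto simp: coord_scale_def v_def)
  then show ?thesis by auto
qed

lemma V_act_basis:
  assumes "i \<le> n"
  shows "V_act n sl2_e (v n i) = coord_scale (of_nat i * (of_nat n + 1 - of_nat i)) (v n (i - 1))"
    and "V_act n sl2_h (v n i) = coord_scale (of_nat n - 2 * of_nat i) (v n i)"
    and "V_act n sl2_f (v n i) = v n (i + 1)"
  using assms
  by (auto simp: fun_eq_iff V_act_def coord_scale_def e_act_apply h_act_apply f_act_apply
      sl2_e_def sl2_h_def sl2_f_def v_def)

lemma vector_space_mat: "vector_space mat_scale"
  by unfold_locales (simp_all add: mat_scale_def vec_eq_iff algebra_simps)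

lemma vector_space_coord: "vector_space coord_scale"
  by unfold_locales (simp_all add: coord_scale_def fun_eq_iff algebra_simps)

interpretation mat: vector_space mat_scale by (rule vector_space_mat)
interpretation coord: vector_space coord_scale by (rule vector_space_coord)

lemma subspace_sl2: "mat.subspace sl2"
  by (auto simp: mat.subspace_def sl2_def trace_def mat_scale_def sum_2 algebra_simps
      simp flip: distrib_left)

lemma span_sl2: "sl2 = mat.span {sl2_e, sl2_h, sl2_f}"
proof
  show "sl2 \<subseteq> mat.span {sl2_e, sl2_h, sl2_f}"
  proof
    fix A assume "A \<in> sl2"
    then show "A \<in> mat.span {sl2_e, sl2_h, sl2_f}"
      by (subst sl2_decomp, assumption, intro mat.span_add mat.span_scale mat.span_base) simp_all
  qed
  show "mat.span {sl2_e, sl2_h, sl2_f} \<subseteq> sl2"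
    by (rule mat.span_minimal) (auto simp: sl2_basis_in subspace_sl2)
qed

lemma subspace_V: "coord.subspace (V n)"
  by (auto simp: coord.subspace_def V_def coord_scale_def)

lemma V_expand:
  assumes "x \<in> V n"
  shows "x = (\<Sum>i\<le>n. coord_scale (x i) (v n i))"
proof
  fix j
  have "(\<Sum>i\<le>n. coord_scale (x i) (v n i)) j = (\<Sum>i\<le>n. if i = j then x i else 0)"
    unfolding sum_fun_apply by (rule sum.cong) (auto simp: coord_scale_def v_def)
  also have "\<dots> = x j" using assms by (auto simp: V_def)
  finally show "x j = (\<Sum>i\<le>n. coord_scale (x i) (v n i)) j" by simp
qed

lemma v_in_V: "v n i \<in> V n"
  by (auto simp: v_def V_def)

lemma span_V: "V n = coord.span (v n ` {..n})"
proof
  show "V n \<subseteq> coord.span (v n ` {..n})"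
  proof
    fix x assume "x \<in> V n"
    then show "x \<in> coord.span (v n ` {..n})"
      by (subst V_expand, assumption, intro coord.span_sum coord.span_scale coord.span_base) simp_all
  qed
  show "coord.span (v n ` {..n}) \<subseteq> V n"
    by (rule coord.span_minimal) (auto simp: v_in_V subspace_V)
qed

lemma commutator_sl2: "commutator A B \<in> sl2"
  by (simp add: sl2_def trace_def commutator_def matrix_matrix_mult_def sum_2)

lemma V_act_apply:
  "V_act n A x j =
     A$1$2 * (if j < n then of_nat (Suc j) * (of_nat n - of_nat j) * x (Suc j) else 0)
   + A$1$1 * (if j \<le> n then (of_nat n - 2 * of_nat j) * x j else 0)
   + A$2$1 * (if 1 \<le> j \<and> j \<le> n then x (j - 1) else 0)"
  by (simp add: V_act_def coord_scale_def e_act_apply h_act_apply f_act_apply)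

lemma V_act_commutator:
  assumes "A \<in> sl2" "B \<in> sl2"
  shows "V_act n (commutator A B) x = V_act n A (V_act n B x) - V_act n B (V_act n A x)"
proof
  fix j
  have t: "A$2$2 = - A$1$1" "B$2$2 = - B$1$1"
    using assms by (simp_all add: sl2_def trace_def sum_2 eq_neg_iff_add_eq_0 add.commute)
  note defs = V_act_apply commutator_def matrix_matrix_mult_def sum_2 t
  consider "j > n" | "j = n" "j = 0" | k where "j = n" "j = Suc k" | "j < n" "j = 0"
    | k where "j < n" "j = Suc k"
    by (cases j; metis linorder_neqE_nat)
  then show "V_act n (commutator A B) x j = (V_act n A (V_act n B x) - V_act n B (V_act n A x)) j"
  proof cases
    case 1 then show ?thesis by (simp add: defs)
  next
    case 2 then show ?thesis by (simp add: defs)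
  next
    case 3 then show ?thesis by (simp add: defs) (simp add: algebra_simps)
  next
    case 4
    then show ?thesis
      by (cases "Suc 0 = n"; simp add: defs) (auto simp: algebra_simps)
  next
    case 5
    then show ?thesis
      by (cases "Suc j = n"; simp add: defs) (auto simp: algebra_simps)
  qed
qed

lemma lie_module_V: "lie_module mat_scale sl2 commutator coord_scale (V n) (V_act n)"
proof (unfold_locales, goal_cases)
  case 1 show ?case by (rule subspace_sl2)
next
  case 2 show ?case by (intro exI[of _ "{sl2_e, sl2_h, sl2_f}"] conjI span_sl2) simp
next
  case 3 show ?case by (rule commutator_sl2)
next
  case (4 A B C) show ?case
    by (simp add: commutator_def matrix_matrix_mult_def sum_2 vec_eq_iff algebra_simps)
next
  case (5 A B C) show ?case
    by (simp add: commutator_def matrix_matrix_mult_def sum_2 vec_eq_iff algebra_simps)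
next
  case (6 A B c) show ?case
    by (simp add: commutator_def mat_scale_def matrix_matrix_mult_def sum_2 vec_eq_iff algebra_simps)
next
  case (7 A B c) show ?case
    by (simp add: commutator_def mat_scale_def matrix_matrix_mult_def sum_2 vec_eq_iff algebra_simps)
next
  case 8 show ?case by (simp add: commutator_def)
next
  case (9 A B C) show ?case
    by (simp add: commutator_def matrix_matrix_mult_def sum_2 vec_eq_iff algebra_simps)
next
  case 10 show ?case by (rule subspace_V)
next
  case 11 show ?case by (intro exI[of _ "v n ` {..n}"] conjI span_V) simp
next
  case 12 show ?case by (simp add: V_def V_act_apply)
next
  case 13 show ?case by (simp add: fun_eq_iff V_act_apply algebra_simps)
next
  case 14 show ?case by (simp add: fun_eq_iff V_act_apply algebra_simps)
next
  case 15 show ?case by (simp add: fun_eq_iff V_act_apply mat_scale_def coord_scale_def algebra_simps)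
next
  case 16 show ?case by (simp add: fun_eq_iff V_act_apply coord_scale_def algebra_simps)
next
  case 17 show ?case by (rule V_act_commutator[OF 17(1,2)])
qed

global_interpretation sl2_V: lie_module mat_scale sl2 commutator coord_scale "V n" "V_act n" for n
  by (rule lie_module_V)

lemma simple_V: "sl2_V.simple_module n"
  unfolding sl2_V.simple_module_def
proof (intro conjI allI impI)
  have "v n 0 0 = 1" by (simp add: v_def)
  then show "V n \<noteq> {0}" using v_in_V[of n 0] by (metis singletonD zero_fun_apply zero_neq_one)
next
  fix W
  assume W: "coord.subspace W \<and> W \<subseteq> V n \<and> (\<forall>A\<in>sl2. \<forall>w\<in>W. V_act n A w \<in> W)"
  then have Wsub: "coord.subspace W" and WV: "\<And>w. w \<in> W \<Longrightarrow> w \<in> V n"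
    and Wact: "\<And>A w. A \<in> sl2 \<Longrightarrow> w \<in> W \<Longrightarrow> V_act n A w \<in> W"
    by auto
  show "W = {0} \<or> W = V n"
  proof (cases "W = {0}")
    case False
    then obtain x where x: "x \<in> W" "x \<noteq> 0"
      using coord.subspace_0[OF Wsub] by auto
    have scale: "w \<in> W" if "coord_scale c w \<in> W" "c \<noteq> 0" for c w
    proof -
      have "coord_scale (inverse c) (coord_scale c w) \<in> W"
        by (rule coord.subspace_scale[OF Wsub that(1)])
      then show ?thesis using that(2) by simp
    qed
    \<comment> \<open>Raising by \<open>e\<close> lowers the top index of the support until a multiple of \<open>v\<^sub>0\<close> remains.\<close>
    have "v n 0 \<in> W" if "y \<in> W" "y m \<noteq> 0" "\<forall>j>m. y j = 0" for y m
      using that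
    proof (induction m arbitrary: y)
      case 0
      have "y = coord_scale (y 0) (v n 0)"
        using 0 by (auto simp: fun_eq_iff coord_scale_def v_def)
      then show ?case using scale[of "y 0" "v n 0"] 0 by simp
    next
      case (Suc m)
      have m: "m < n"
        using WV[OF Suc.prems(1)] Suc.prems(2) by (auto simp: V_def Suc_le_eq intro: ccontr)
      have e: "V_act n sl2_e y j =
        (if j < n then of_nat (Suc j) * (of_nat n - of_nat j) * y (Suc j) else 0)" for j
        by (simp add: V_act_apply sl2_e_def)
      have "V_act n sl2_e y \<in> W" by (rule Wact[OF sl2_basis_in(1) Suc.prems(1)])
      moreover have "V_act n sl2_e y m \<noteq> 0"
        using m Suc.prems(2) by (simp add: e del: of_nat_Suc)
      moreover have "\<forall>j>m. V_act n sl2_e y j = 0"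
        using Suc.prems(3) by (simp add: e)
      ultimately show ?case by (rule Suc.IH)
    qed
    moreover have "\<exists>m. x m \<noteq> 0 \<and> (\<forall>j>m. x j = 0)"
    proof -
      obtain i where i: "x i \<noteq> 0" using x(2) by (auto simp: fun_eq_iff)
      have b: "\<And>j. x j \<noteq> 0 \<Longrightarrow> j \<le> n"
        using WV[OF x(1)] by (auto simp: V_def intro: ccontr)
      have fin: "finite {j. x j \<noteq> 0}"
        by (rule finite_subset[of _ "{..n}"]) (auto dest: b)
      show ?thesis
        using Max_in[OF fin] Max_ge[OF fin] i by (intro exI[of _ "Max {j. x j \<noteq> 0}"]) fastforce
    qed
    ultimately have v0: "v n 0 \<in> W" using x(1) by metis
    have vi: "v n i \<in> W" if "i \<le> n" for i
      using that
    proof (induction i)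
      case (Suc i)
      then have "V_act n sl2_f (v n i) \<in> W" by (intro Wact sl2_basis_in) simp
      then show ?case using Suc.prems V_act_basis(3)[of i n] by simp
    qed (use v0 in simp)
    have "V n \<subseteq> W"
      unfolding span_V by (rule coord.span_minimal[OF _ Wsub]) (auto simp: vi)
    then show ?thesis using WV by auto
  qed simp
qed

end

theory Submission
  imports Defs
begin

text \<open>Every derivation \<open>D\<close> of \<open>sl(2)\<close> on \<open>V(n)\<close> is inner, that is, \<open>D x = x \<cdot> u\<close> for a fixed
  vector \<open>u\<close> (\<open>derivation_imp_inner\<close>). For \<open>n = 0\<close> both sides vanish because \<open>sl(2)\<close> is perfect;
  for \<open>n > 0\<close> the Casimir operator \<open>2ef + 2fe + h\<^sup>2\<close> acts on \<open>V(n)\<close> as the nonzero scalar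
  \<open>n(n + 2)\<close>, and replacing the right factor of each summand by its image under \<open>D\<close> yields
  \<open>n(n + 2)\<close> times such a \<open>u\<close>.

  A 2-local derivation \<open>g\<close> thus satisfies \<open>g x = x \<cdot> u\<close> and \<open>g y = y \<cdot> u\<close> with \<open>u\<close> depending on
  \<open>x\<close> and \<open>y\<close>. Let \<open>u\<^sub>0\<close> serve the pair \<open>(h, e)\<close>. Comparing the vectors of the pairs \<open>(h, x)\<close>
  and \<open>(e, x)\<close> with \<open>u\<^sub>0\<close> shows that \<open>g x - x \<cdot> u\<^sub>0\<close> lies both in the image under \<open>x\<close> of \<open>ker h\<close>,
  which is zero or spanned by the middle vector \<open>v\<^bsub>n/2\<^esub>\<close>, and in the image under \<open>x\<close> of
  \<open>ker e\<close>, which is spanned by \<open>v\<^sub>0\<close>. Let \<open>n > 0\<close>, the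
  action being zero otherwise. If \<open>x\<close> has a nonzero \<open>f\<close>-component, it moves a nonzero
  middle vector to a position that \<open>x \<cdot> v\<^sub>0\<close> does not reach, so \<open>g x = x \<cdot> u\<^sub>0\<close>. In particular
  this holds for \<open>x = f\<close>, so for the remaining \<open>x\<close>, those in the span of \<open>e\<close> and \<open>h\<close>, the
  kernel of \<open>f\<close>, spanned by \<open>v\<^sub>n\<close>, can take the role of \<open>ker e\<close>: now \<open>x\<close> moves the middle
  vector to position \<open>n/2 - 1\<close>, which \<open>x \<cdot> v\<^sub>n\<close> does not reach. Hence \<open>g x = x \<cdot> u\<^sub>0\<close> for all
  \<open>x\<close>.\<close>

section \<open>The action on \<open>V(n)\<close> and its kernels\<close>

lemma V_act_add: "V_act n A (x + y) = V_act n A x + V_act n A y"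
  by (simp add: fun_eq_iff V_act_apply algebra_simps)

lemma V_act_diff: "V_act n A (x - y) = V_act n A x - V_act n A y"
  by (simp add: fun_eq_iff V_act_apply algebra_simps)

lemma V_act_scale: "V_act n A (coord_scale c x) = coord_scale c (V_act n A x)"
  by (simp add: fun_eq_iff V_act_apply coord_scale_def algebra_simps)

lemma V_act_mat_scale: "V_act n (mat_scale c A) x = coord_scale c (V_act n A x)"
  by (simp add: fun_eq_iff V_act_apply mat_scale_def coord_scale_def algebra_simps)

lemma V_act_in_V: "V_act n A x \<in> V n"
  by (simp add: V_def V_act_apply)

lemma V_act_e_apply:
  "V_act n sl2_e x j = (if j < n then of_nat (Suc j) * (of_nat n - of_nat j) * x (Suc j) else 0)"
  by (simp add: V_act_apply sl2_e_def)

lemma V_act_h_apply: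
  "V_act n sl2_h x j = (if j \<le> n then (of_nat n - 2 * of_nat j) * x j else 0)"
  by (simp add: V_act_apply sl2_h_def)

lemma V_act_f_apply:
  "V_act n sl2_f x j = (if 1 \<le> j \<and> j \<le> n then x (j - 1) else 0)"
  by (simp add: V_act_apply sl2_f_def)

lemma V_act_zero_weight: "V_act 0 A x = 0"
  by (simp add: fun_eq_iff V_act_apply)

lemma ker_e:
  assumes "V_act n sl2_e x = 0" "x \<in> V n" "j > 0"
  shows "x j = 0"
proof (cases "j \<le> n")
  case True
  with assms(3) obtain k where k: "j = Suc k" "k < n"
    by (cases j) auto
  then have "of_nat (Suc k) * (of_nat n - of_nat k) * x (Suc k) = 0"
    using fun_cong[OF assms(1), of k] by (simp add: V_act_e_apply del: of_nat_Suc)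
  then show ?thesis using k by (simp del: of_nat_Suc)
qed (use assms(2) in \<open>simp add: V_def\<close>)

lemma ker_h:
  assumes "V_act n sl2_h x = 0" "x \<in> V n" "2 * j \<noteq> n"
  shows "x j = 0"
proof (cases "j \<le> n")
  case True
  then have "(of_nat n - of_nat (2 * j) :: complex) * x j = 0"
    using fun_cong[OF assms(1), of j] by (simp add: V_act_h_apply)
  then show ?thesis using assms(3) by (simp del: of_nat_mult)
qed (use assms(2) in \<open>simp add: V_def\<close>)

lemma ker_f:
  assumes "V_act n sl2_f x = 0" "x \<in> V n" "j \<noteq> n"
  shows "x j = 0"
proof (cases "j < n")
  case True
  then show ?thesis
    using fun_cong[OF assms(1), of "Suc j"] by (simp add: V_act_f_apply)
qed (use assms(2,3) in \<open>simp add: V_def\<close>)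

section \<open>Derivations on \<open>V(n)\<close> are inner\<close>

lemma sl2_brackets:
  "commutator sl2_h sl2_e = mat_scale 2 sl2_e"
  "commutator sl2_h sl2_f = mat_scale (-2) sl2_f"
  "commutator sl2_e sl2_f = sl2_h"
  by (simp_all add: commutator_def mat_scale_def sl2_e_def sl2_h_def sl2_f_def
      matrix_matrix_mult_def sum_2 vec_eq_iff forall_2)

lemma casimir_scalar:
  assumes "x \<in> V n"
  shows "coord_scale 2 (V_act n sl2_e (V_act n sl2_f x))
       + coord_scale 2 (V_act n sl2_f (V_act n sl2_e x))
       + V_act n sl2_h (V_act n sl2_h x) = coord_scale (of_nat (n * (n + 2))) x"
proof
  fix j
  consider "j > n" | "j = 0" | k where "j = Suc k" "j \<le> n"
    by (cases j; cases "j \<le> n") auto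
  then show "(coord_scale 2 (V_act n sl2_e (V_act n sl2_f x))
       + coord_scale 2 (V_act n sl2_f (V_act n sl2_e x))
       + V_act n sl2_h (V_act n sl2_h x)) j = coord_scale (of_nat (n * (n + 2))) x j"
    using assms
    by cases (auto simp: V_def coord_scale_def V_act_e_apply V_act_f_apply V_act_h_apply
        algebra_simps)
qed

lemma inner_derivation:
  assumes "u \<in> V n" "\<And>x. x \<in> sl2 \<Longrightarrow> g x = V_act n x u"
  shows "sl2_V.derivation n g"
  unfolding sl2_V.derivation_def
proof (intro conjI ballI allI)
  show "g \<in> sl2 \<rightarrow> V n"
    using assms(2) by (simp add: V_act_in_V)
next
  fix x y assume "x \<in> sl2" "y \<in> sl2"
  then show "g (x + y) = g x + g y"
    using assms sl2_V.act_add_left mat.subspace_add[OF subspace_sl2] by simp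
next
  fix c x assume "x \<in> sl2"
  then show "g (mat_scale c x) = coord_scale c (g x)"
    using assms sl2_V.act_scale_left mat.subspace_scale[OF subspace_sl2] by simp
next
  fix x y assume "x \<in> sl2" "y \<in> sl2"
  then show "g (commutator x y) = V_act n x (g y) - V_act n y (g x)"
    using assms V_act_commutator commutator_sl2 by simp
qed

lemma derivation_expand:
  assumes "sl2_V.derivation n D" "x \<in> sl2"
  shows "D x = coord_scale (x$1$2) (D sl2_e) + coord_scale (x$1$1) (D sl2_h)
      + coord_scale (x$2$1) (D sl2_f)"
proof -
  have add: "D (a + b) = D a + D b" if "a \<in> sl2" "b \<in> sl2" for a b
    using assms(1) that unfolding sl2_V.derivation_def by blast
  have scale: "D (mat_scale c a) = coord_scale c (D a)" if "a \<in> sl2" for a c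
    using assms(1) that unfolding sl2_V.derivation_def by blast
  note closed = mat.subspace_add[OF subspace_sl2] mat.subspace_scale[OF subspace_sl2]
  show ?thesis
    by (subst sl2_decomp[OF assms(2)]) (simp add: add scale closed sl2_basis_in)
qed

lemma derivation_basis:
  assumes "sl2_V.derivation n D"
  shows "coord_scale 2 (D sl2_e) = V_act n sl2_h (D sl2_e) - V_act n sl2_e (D sl2_h)"
    and "coord_scale (-2) (D sl2_f) = V_act n sl2_h (D sl2_f) - V_act n sl2_f (D sl2_h)"
    and "D sl2_h = V_act n sl2_e (D sl2_f) - V_act n sl2_f (D sl2_e)"
proof -
  have bracket: "D (commutator a b) = V_act n a (D b) - V_act n b (D a)"
    if "a \<in> sl2" "b \<in> sl2" for a b
    using assms that unfolding sl2_V.derivation_def by blast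
  have scale: "D (mat_scale c a) = coord_scale c (D a)" if "a \<in> sl2" for a c
    using assms that unfolding sl2_V.derivation_def by blast
  show "coord_scale 2 (D sl2_e) = V_act n sl2_h (D sl2_e) - V_act n sl2_e (D sl2_h)"
    using bracket[OF sl2_basis_in(2,1)] by (simp only: sl2_brackets scale sl2_basis_in)
  show "coord_scale (-2) (D sl2_f) = V_act n sl2_h (D sl2_f) - V_act n sl2_f (D sl2_h)"
    using bracket[OF sl2_basis_in(2,3)] by (simp only: sl2_brackets scale sl2_basis_in)
  show "D sl2_h = V_act n sl2_e (D sl2_f) - V_act n sl2_f (D sl2_e)"
    using bracket[OF sl2_basis_in(1,3)] by (simp add: sl2_brackets)
qed

text \<open>If \<open>D\<close> is the inner derivation of \<open>u\<close>, the vector acted on by \<open>x\<close> below is the Casimir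
  operator applied to \<open>u\<close>, and the identity says that the Casimir operator commutes with \<open>x\<close>. For
  a general \<open>D\<close> the reason is the same: moving \<open>x\<close> past a left factor costs a commutator,
  and so does exchanging \<open>x\<close> with the argument of \<open>D\<close>, by the derivation rule; since the
  Casimir element is invariant, these two kinds of commutators cancel in the sum.\<close>

lemma casimir_derivation:
  assumes D: "sl2_V.derivation n D" and x: "x \<in> sl2"
  shows "V_act n x (coord_scale 2 (V_act n sl2_e (D sl2_f))
       + coord_scale 2 (V_act n sl2_f (D sl2_e)) + V_act n sl2_h (D sl2_h))
     = coord_scale (of_nat (n * (n + 2))) (D x)"
proof -
  let ?e = "V_act n sl2_e" and ?h = "V_act n sl2_h" and ?f = "V_act n sl2_f"
  let ?c = "coord_scale (of_nat (n * (n + 2)))"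
  define a b c where "a = D sl2_e" and "b = D sl2_h" and "c = D sl2_f"
  have V: "a \<in> V n" "b \<in> V n" "c \<in> V n"
    using D sl2_basis_in unfolding sl2_V.derivation_def a_def b_def c_def by auto
  have two: "coord_scale 2 y = y + y" "coord_scale (-2) y = - y - y" for y
    by (simp_all add: coord_scale_def fun_eq_iff)
  \<comment> \<open>Read as rewrite rules, these relations bring every word to the order \<open>f\<close>, \<open>e\<close>, \<open>h\<close>; the
    relations after them then remove \<open>h\<close> in front of \<open>a\<close> and \<open>c\<close>, and \<open>e\<close> in front of \<open>c\<close>.\<close>
  have he: "?h (?e y) = ?e (?h y) + ?e y + ?e y" for y
    using V_act_commutator[OF sl2_basis_in(2,1), of n y]
    unfolding sl2_brackets V_act_mat_scale two by (simp add: algebra_simps)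
  have hf: "?h (?f y) = ?f (?h y) - ?f y - ?f y" for y
    using V_act_commutator[OF sl2_basis_in(2,3), of n y]
    unfolding sl2_brackets V_act_mat_scale two by (simp add: algebra_simps)
  have ef: "?e (?f y) = ?f (?e y) + ?h y" for y
    using V_act_commutator[OF sl2_basis_in(1,3), of n y] by (simp add: sl2_brackets algebra_simps)
  note basis = derivation_basis[OF D, folded a_def b_def c_def, unfolded two]
  have ha: "?h a = ?e b + a + a"
    using basis(1) by (simp add: algebra_simps)
  have hc: "?h c = ?f b - c - c"
    using basis(2) by (simp add: algebra_simps)
  have ec: "?e c = ?f a + b"
    using basis(3) by simp
  let ?u = "coord_scale 2 (?e c) + coord_scale 2 (?f a) + ?h b"
  note lin = two V_act_add V_act_diff
  have basis_case: "?e ?u = ?c a" "?h ?u = ?c b" "?f ?u = ?c c"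
    unfolding casimir_scalar[OF V(1), symmetric] casimir_scalar[OF V(2), symmetric]
      casimir_scalar[OF V(3), symmetric]
    unfolding lin ha hc ec he hf ef
    by (simp_all add: algebra_simps)
  have "V_act n x y
      = coord_scale (x$1$2) (?e y) + coord_scale (x$1$1) (?h y) + coord_scale (x$2$1) (?f y)" for y
    by (simp add: V_act_apply sl2_e_def sl2_h_def sl2_f_def coord_scale_def fun_eq_iff)
  then have "V_act n x ?u
      = coord_scale (x$1$2) (?c a) + coord_scale (x$1$1) (?c b) + coord_scale (x$2$1) (?c c)"
    by (simp only: basis_case)
  also have "\<dots> = ?c (D x)"
    unfolding derivation_expand[OF D x] a_def b_def c_def
    by (simp add: coord_scale_def fun_eq_iff algebra_simps)
  finally show ?thesis
    unfolding a_def b_def c_def .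
qed

lemma derivation_imp_inner:
  assumes D: "sl2_V.derivation n D"
  obtains u where "u \<in> V n" "\<And>x. x \<in> sl2 \<Longrightarrow> D x = V_act n x u"
proof (cases "n = 0")
  case True
  have "coord_scale 2 (D sl2_e) = 0" "coord_scale (-2) (D sl2_f) = 0" "D sl2_h = 0"
    using derivation_basis[OF D] True by (simp_all add: V_act_zero_weight)
  then have "D x = V_act n x 0" if "x \<in> sl2" for x
    using derivation_expand[OF D that] True by (simp add: V_act_zero_weight)
  moreover have "0 \<in> V n" by (simp add: V_def)
  ultimately show ?thesis using that by blast
next
  case False
  define w where "w = coord_scale 2 (V_act n sl2_e (D sl2_f))
    + coord_scale 2 (V_act n sl2_f (D sl2_e)) + V_act n sl2_h (D sl2_h)"
  let ?c = "of_nat (n * (n + 2)) :: complex"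
  have c: "?c \<noteq> 0" using False by (simp only: of_nat_eq_0_iff) simp
  have "w \<in> V n"
    unfolding w_def
    by (intro coord.subspace_add[OF subspace_V] coord.subspace_scale[OF subspace_V] V_act_in_V)
  then have "coord_scale (inverse ?c) w \<in> V n"
    by (rule coord.subspace_scale[OF subspace_V])
  moreover have "D x = V_act n x (coord_scale (inverse ?c) w)" if "x \<in> sl2" for x
    using casimir_derivation[OF D that, folded w_def] c
    by (simp add: V_act_scale del: of_nat_mult of_nat_add)
  ultimately show ?thesis using that by blast
qed

section \<open>2-local derivations\<close>

lemma two_local_derivation_pair:
  assumes "sl2_V.two_local_derivation n g" "x \<in> sl2" "y \<in> sl2"
  obtains u where "u \<in> V n" "g x = V_act n x u" "g y = V_act n y u"
proof -
  obtain D where D: "sl2_V.derivation n D" "g x = D x" "g y = D y"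
    using assms unfolding sl2_V.two_local_derivation_def by blast
  obtain u where "u \<in> V n" "\<And>z. z \<in> sl2 \<Longrightarrow> D z = V_act n z u"
    using derivation_imp_inner[OF D(1)] by blast
  then show ?thesis using that D assms(2,3) by simp
qed

text \<open>The form in which the 2-local property is used: where \<open>g\<close> is known to agree with the inner
  derivation of \<open>u\<^sub>0\<close>, the error it makes elsewhere is controlled by a kernel.\<close>

lemma two_local_derivation_error:
  assumes "sl2_V.two_local_derivation n g" "x \<in> sl2" "y \<in> sl2"
    and "u0 \<in> V n" "g y = V_act n y u0"
  obtains w where "w \<in> V n" "V_act n y w = 0" "g x - V_act n x u0 = V_act n x w"
proof -
  obtain u where u: "u \<in> V n" "g x = V_act n x u" "g y = V_act n y u"
    using two_local_derivation_pair[OF assms(1-3)] .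
  show ?thesis
  proof (rule that[of "u - u0"])
    show "u - u0 \<in> V n" using u(1) assms(4) by (rule coord.subspace_diff[OF subspace_V])
  qed (use u assms(5) in \<open>simp_all add: V_act_diff\<close>)
qed

text \<open>For odd \<open>n\<close> the kernel of \<open>h\<close> is zero. For \<open>n = 2m > 0\<close>, compare the coefficients of
  \<open>v\<^bsub>m+1\<^esub>\<close> in \<open>x \<cdot> w = x \<cdot> z\<close>: on the left only the \<open>f\<close>-component of \<open>x\<close> contributes, and on the
  right the coefficient vanishes since \<open>z\<close> is a multiple of \<open>v\<^sub>0\<close> and \<open>x \<cdot> v\<^sub>0\<close> involves only \<open>v\<^sub>0\<close> and \<open>v\<^sub>1\<close>.\<close>

lemma ker_h_ker_e_images:
  assumes w: "w \<in> V n" "V_act n sl2_h w = 0" and z: "z \<in> V n" "V_act n sl2_e z = 0"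
    and eq: "V_act n x w = V_act n x z" and x: "x$2$1 \<noteq> 0"
  shows "V_act n x w = 0"
proof (cases "n = 0")
  case False
  have "w j = 0" for j
  proof (cases "2 * j = n")
    case True
    note wz = ker_h[OF w(2,1)] ker_e[OF z(2,1)]
    have "V_act n x w (Suc j) = x$2$1 * w j" "V_act n x z (Suc j) = 0"
      using True False by (auto simp: V_act_apply wz)
    then show ?thesis using eq x by simp
  qed (rule ker_h[OF w(2,1)])
  then show ?thesis by (simp add: fun_eq_iff V_act_apply)
qed (simp add: V_act_zero_weight)

text \<open>For \<open>n = 2m > 0\<close> the vector \<open>x \<cdot> w\<close> is a multiple of \<open>v\<^bsub>m-1\<^esub>\<close>, whereas \<open>x \<cdot> z\<close> involves only \<open>v\<^bsub>n-1\<^esub>\<close> and \<open>v\<^sub>n\<close>.\<close>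

lemma ker_h_ker_f_images:
  assumes w: "w \<in> V n" "V_act n sl2_h w = 0" and z: "z \<in> V n" "V_act n sl2_f z = 0"
    and eq: "V_act n x w = V_act n x z" and x: "x$2$1 = 0"
  shows "V_act n x w = 0"
proof
  fix j
  note wz = ker_h[OF w(2,1)] ker_f[OF z(2,1)]
  show "V_act n x w j = 0 j"
  proof (cases "Suc j < n")
    case True
    then have "V_act n x z j = 0" by (simp add: V_act_apply wz x)
    then show ?thesis using eq by simp
  next
    case False
    have "(of_nat n - 2 * of_nat j) * w j = 0"
      using ker_h[OF w(2,1), of j] by (cases "2 * j = n") auto
    moreover have "w (Suc j) = 0 \<or> n \<le> j"
      using ker_h[OF w(2,1), of "Suc j"] False by (cases "2 * Suc j = n") auto
    ultimately show ?thesis by (auto simp: V_act_apply x)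
  qed
qed

theorem theorem1p1:
  fixes n :: nat and g :: "complex^2^2 \<Rightarrow> nat \<Rightarrow> complex"
  assumes "sl2_V.two_local_derivation n g"
  shows "sl2_V.derivation n g"
proof -
  obtain u where u: "u \<in> V n" and h: "g sl2_h = V_act n sl2_h u" and e: "g sl2_e = V_act n sl2_e u"
    using two_local_derivation_pair[OF assms sl2_basis_in(2,1)] .
  note error = two_local_derivation_error[OF assms _ _ u]
  have lower: "g x = V_act n x u" if x: "x \<in> sl2" "x$2$1 \<noteq> 0" for x
  proof -
    obtain w where w: "w \<in> V n" "V_act n sl2_h w = 0" "g x - V_act n x u = V_act n x w"
      using error[OF x(1) sl2_basis_in(2) h] .
    obtain z where z: "z \<in> V n" "V_act n sl2_e z = 0" "g x - V_act n x u = V_act n x z"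
      using error[OF x(1) sl2_basis_in(1) e] .
    have "V_act n x w = 0"
      using ker_h_ker_e_images[OF w(1,2) z(1,2) _ x(2)] w(3) z(3) by simp
    then show ?thesis using w(3) by simp
  qed
  have f: "g sl2_f = V_act n sl2_f u"
    by (rule lower[OF sl2_basis_in(3)]) (simp add: sl2_f_def)
  have upper: "g x = V_act n x u" if x: "x \<in> sl2" "x$2$1 = 0" for x
  proof -
    obtain w where w: "w \<in> V n" "V_act n sl2_h w = 0" "g x - V_act n x u = V_act n x w"
      using error[OF x(1) sl2_basis_in(2) h] .
    obtain z where z: "z \<in> V n" "V_act n sl2_f z = 0" "g x - V_act n x u = V_act n x z"
      using error[OF x(1) sl2_basis_in(3) f] .
    have "V_act n x w = 0"
      using ker_h_ker_f_images[OF w(1,2) z(1,2) _ x(2)] w(3) z(3) by simp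
    then show ?thesis using w(3) by simp
  qed
  show ?thesis
    using lower upper by (intro inner_derivation[OF u]) blast
qed

end
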